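(* Let $\mathcal{T},\mathcal{A}\in\Pi_3$. The partial integral equation (PIE) $\mathcal{T}\dot{\mathbf{x}}=\mathcal{A}\mathbf{x}$ is: (1) FE PIE to PDE stable if there exist $\mathcal{Q}\in\Pi_3$ and $\alpha>0$ such that $\mathcal{Q}\mathcal{T}=(\mathcal{Q}\mathcal{T})^*\ge0$ and $\mathcal{Q}\mathcal{A}+\mathcal{A}^*\mathcal{Q}^*\le-\alpha\mathcal{T}^*\mathcal{T}$; (2) FE PIE stable if there exist $\mathcal{Q}\in\Pi_3$ and $\alpha>0$ such that $\mathcal{Q}\mathcal{T}=(\mathcal{Q}\mathcal{T})^*\ge0$ and $\mathcal{Q}\mathcal{A}+\mathcal{A}^*\mathcal{Q}^*\le-\alpha I$; (3) FE PDE stable if there exist $\mathcal{P}=\mathcal{P}^*\in\Pi_3$ and $\alpha>0$ such that $\mathcal{P}\ge0$ and $\mathcal{T}^*\mathcal{P}\mathcal{A}+\mathcal{A}^*\mathcal{P}\mathcal{T}\le-\alpha\mathcal{T}^*\mathcal{T}$; (4) FE PDE to PIE stable if there exist $\mathcal{Q}\in\Pi_3$ and $C,\alpha>0$ such that $\mathcal{Q}\mathcal{T}=(\mathcal{Q}\mathcal{T})^*\ge0$, $\mathcal{Q}\mathcal{T}\le C\mathcal{T}^*\mathcal{T}$ and $\mathcal{Q}\mathcal{A}+\mathcal{A}^*\mathcal{Q}^*\le-\alpha I$.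
   Context: $L_2$ denotes the real Hilbert space $L_2([0,1];\mathbb{R}^m)$ with inner product $\langle\cdot,\cdot\rangle$ and norm $\|\cdot\|$. A partial integral (PI) operator is a bounded linear operator $\mathcal{P}:L_2\to L_2$ of the form $(\mathcal{P}\mathbf{x})(s)=R_0(s)\mathbf{x}(s)+\int_0^s R_1(s,\theta)\mathbf{x}(\theta)\,d\theta+\int_s^1R_2(s,\theta)\mathbf{x}(\theta)\,d\theta$ with (matrix-valued) $R_0\in L_\infty$ and $R_1,R_2\in L_2$; $\Pi_3$ is the set of all such operators. Adjoints $(\cdot)^*$ are with respect to the $L_2$ inner product, $I$ is the identity, and an operator inequality $\mathcal{M}\ge\mathcal{N}$ means $\langle\mathbf{x},\mathcal{M}\mathbf{x}\rangle\ge\langle\mathbf{x},\mathcal{N}\mathbf{x}\rangle$ for all $\mathbf{x}\in L_2$. A solution of $\mathcal{T}\dot{\mathbf{x}}=\mathcal{A}\mathbf{x}$ is a differentiable function $\mathbf{x}:[0,\infty)\to L_2$ with $\mathcal{T}\dot{\mathbf{x}}(t)=\mathcal{A}\mathbf{x}(t)$ for all $t\ge 0$. (When the PIE comes from a classically well-posed PDE, $\mathcal{T}\mathbf{x}(t)$ is the PDE state; this only motivates the terminology.) Finite-energy (FE) stability: the PIE is called - FE PIE to PDE stable if there is $C>0$ such that every solution satisfies $\left(\int_0^\infty\|\mathcal{T}\mathbf{x}(t)\|^2dt\right)^{1/2}\le C\|\mathbf{x}(0)\|$; - FE PIE stable if there is $C>0$ such that every solution satisfies $\left(\int_0^\infty\|\mathbf{x}(t)\|^2dt\right)^{1/2}\le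 C\|\mathbf{x}(0)\|$; - FE PDE stable if there is $C>0$ such that every solution satisfies $\left(\int_0^\infty\|\mathcal{T}\mathbf{x}(t)\|^2dt\right)^{1/2}\le C\|\mathcal{T}\mathbf{x}(0)\|$; - FE PDE to PIE stable if there is $C>0$ such that every solution satisfies $\left(\int_0^\infty\|\mathbf{x}(t)\|^2dt\right)^{1/2}\le C\|\mathcal{T}\mathbf{x}(0)\|$. *)

theory Defs
  imports "HOL-Analysis.Analysis"
begin

definition square_integrable :: "'a measure \<Rightarrow> ('a \<Rightarrow> 'b::real_normed_vector) \<Rightarrow> bool" where
  "square_integrable M f \<longleftrightarrow>
     f \<in> borel_measurable M \<and> integrable M (\<lambda>s. (norm (f s))\<^sup>2)"

lemma square_integrable_zero: "square_integrable M (\<lambda>s. 0)"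
  by (simp add: square_integrable_def)

lemma square_integrable_add:
  fixes f g :: "'a \<Rightarrow> 'b::euclidean_space"
  assumes "square_integrable M f" "square_integrable M g"
  shows "square_integrable M (\<lambda>s. f s + g s)"
proof -
  have [measurable]: "f \<in> borel_measurable M" "g \<in> borel_measurable M"
    using assms by (auto simp: square_integrable_def)
  have "integrable M (\<lambda>s. 2 * (norm (f s))\<^sup>2 + 2 * (norm (g s))\<^sup>2)"
    using assms by (auto simp: square_integrable_def)
  moreover have "(norm (f s + g s))\<^sup>2 \<le> 2 * (norm (f s))\<^sup>2 + 2 * (norm (g s))\<^sup>2" for s
  proof -
    have "(norm (f s + g s))\<^sup>2 \<le> (norm (f s) + norm (g s))\<^sup>2"
      by (intro power_mono norm_triangle_ineq) auto
    also have "\<dots> \<le> 2 * (norm (f s))\<^sup>2 + 2 * (norm (g s))\<^sup>2"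
      using sum_squares_bound[of "norm (f s)" "norm (g s)"] by (simp add: power2_sum)
    finally show ?thesis .
  qed
  ultimately have "integrable M (\<lambda>s. (norm (f s + g s))\<^sup>2)"
    by (elim Bochner_Integration.integrable_bound) (auto intro!: AE_I2)
  then show ?thesis by (simp add: square_integrable_def)
qed

lemma square_integrable_scaleR:
  fixes f :: "'a \<Rightarrow> 'b::euclidean_space"
  assumes "square_integrable M f"
  shows "square_integrable M (\<lambda>s. c *\<^sub>R f s)"
  using assms by (auto simp: square_integrable_def power_mult_distrib)

lemma square_integrable_inner:
  fixes f g :: "'a \<Rightarrow> 'b::euclidean_space"
  assumes "square_integrable M f" "square_integrable M g"
  shows "integrable M (\<lambda>s. f s \<bullet> g s)"
proof -
  have [measurable]: "f \<in> borel_measurable M" "g \<in> borel_measurable M"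
    using assms by (auto simp: square_integrable_def)
  have "integrable M (\<lambda>s. (norm (f s))\<^sup>2 + (norm (g s))\<^sup>2)"
    using assms by (auto simp: square_integrable_def)
  moreover have "norm (f s \<bullet> g s) \<le> norm ((norm (f s))\<^sup>2 + (norm (g s))\<^sup>2)" for s
  proof -
    have "\<bar>f s \<bullet> g s\<bar> \<le> norm (f s) * norm (g s)"
      by (rule Cauchy_Schwarz_ineq2)
    also have "\<dots> \<le> (norm (f s))\<^sup>2 + (norm (g s))\<^sup>2"
      using sum_squares_bound[of "norm (f s)" "norm (g s)"]
        mult_nonneg_nonneg[OF norm_ge_zero[of "f s"] norm_ge_zero[of "g s"]] by linarith
    finally show ?thesis by simp
  qed
  ultimately show ?thesis
    by (elim Bochner_Integration.integrable_bound) (auto intro!: AE_I2)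
qed

quotient_type 'm L2 = "real \<Rightarrow> real ^ 'm" / partial:
  "\<lambda>f g. square_integrable (lebesgue_on {0..1}) f \<and> square_integrable (lebesgue_on {0..1}) g \<and>
     (AE s in lebesgue_on {0..1}. f s = g s)"
proof (rule part_equivpI)
  show "\<exists>f. square_integrable (lebesgue_on {0..1}) f \<and> square_integrable (lebesgue_on {0..1}) f \<and>
     (AE s in lebesgue_on {0..1}. f s = (f s :: real ^ 'm))"
    by (rule exI[of _ "\<lambda>s. 0"]) (simp add: square_integrable_zero)
qed (auto intro!: sympI transpI elim: AE_mp)

instantiation L2 :: (finite) real_inner
begin

lift_definition zero_L2 :: "'a L2" is "\<lambda>s. 0"
  by (simp add: square_integrable_zero)

lift_definition plus_L2 :: "'a L2 \<Rightarrow> 'a L2 \<Rightarrow> 'a L2" is "\<lambda>f g s. f s + g s"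
  by (auto simp: square_integrable_add)

lift_definition scaleR_L2 :: "real \<Rightarrow> 'a L2 \<Rightarrow> 'a L2" is "\<lambda>c f s. c *\<^sub>R f s"
  by (auto simp: square_integrable_scaleR)

lift_definition inner_L2 :: "'a L2 \<Rightarrow> 'a L2 \<Rightarrow> real" is
  "\<lambda>f g. LINT s|lebesgue_on {0..1}. f s \<bullet> g s"
proof (elim conjE, intro integral_cong_AE)
  fix f g f' g' :: "real \<Rightarrow> real ^ 'a"
  assume f: "square_integrable (lebesgue_on {0..1}) f" "square_integrable (lebesgue_on {0..1}) f'"
    and g: "square_integrable (lebesgue_on {0..1}) g" "square_integrable (lebesgue_on {0..1}) g'"
    and e: "AE s in lebesgue_on {0..1}. f s = f' s" "AE s in lebesgue_on {0..1}. g s = g' s"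
  show "(\<lambda>s. f s \<bullet> g s) \<in> borel_measurable (lebesgue_on {0..1})"
    "(\<lambda>s. f' s \<bullet> g' s) \<in> borel_measurable (lebesgue_on {0..1})"
    using f g square_integrable_inner by blast+
  show "AE s in lebesgue_on {0..1}. f s \<bullet> g s = f' s \<bullet> g' s"
    using e by eventually_elim simp
qed

definition uminus_L2 :: "'a L2 \<Rightarrow> 'a L2" where
  "uminus_L2 x = (- 1) *\<^sub>R x"

definition minus_L2 :: "'a L2 \<Rightarrow> 'a L2 \<Rightarrow> 'a L2" where
  "minus_L2 x y = x + (- 1) *\<^sub>R y"

definition norm_L2 :: "'a L2 \<Rightarrow> real" where
  "norm_L2 x = sqrt (inner x x)"

definition sgn_L2 :: "'a L2 \<Rightarrow> 'a L2" where
  "sgn_L2 x = inverse (norm x) *\<^sub>R x"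

definition dist_L2 :: "'a L2 \<Rightarrow> 'a L2 \<Rightarrow> real" where
  "dist_L2 x y = norm (x - y)"

definition uniformity_L2 :: "('a L2 \<times> 'a L2) filter" where
  "uniformity_L2 = (INF e\<in>{0<..}. principal {(x, y). dist x y < e})"

definition open_L2 :: "'a L2 set \<Rightarrow> bool" where
  "open_L2 U \<longleftrightarrow> (\<forall>x\<in>U. \<forall>\<^sub>F (x', y) in uniformity. x' = x \<longrightarrow> y \<in> U)"

instance
proof
  fix x y z :: "'a L2" and r q :: real
  show "x + y + z = x + (y + z)"
    by transfer (auto simp: add.assoc intro!: square_integrable_add)
  show "x + y = y + x"
    by transfer (auto simp: add.commute intro!: square_integrable_add)
  show "0 + x = x"
    by transfer auto
  show "- x + x = 0"
    unfolding uminus_L2_def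
    by transfer (simp add: square_integrable_zero)
  show "x - y = x + - y"
    by (simp add: minus_L2_def uminus_L2_def)
  show "r *\<^sub>R (x + y) = r *\<^sub>R x + r *\<^sub>R y"
    by transfer (auto simp: scaleR_add_right intro!: square_integrable_add square_integrable_scaleR)
  show "(r + q) *\<^sub>R x = r *\<^sub>R x + q *\<^sub>R x"
    by transfer (auto simp: scaleR_add_left intro!: square_integrable_add square_integrable_scaleR)
  show "r *\<^sub>R q *\<^sub>R x = (r * q) *\<^sub>R x"
    by transfer (auto intro!: square_integrable_scaleR)
  show "1 *\<^sub>R x = x"
    by transfer auto
  show "sgn x = inverse (norm x) *\<^sub>R x"
    by (fact sgn_L2_def)
  show "dist x y = norm (x - y)"
    by (fact dist_L2_def)
  show "uniformity = (INF e\<in>{0<..}. principal {(x, y :: 'a L2). dist x y < e})"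
    by (fact uniformity_L2_def)
  show "open U \<longleftrightarrow> (\<forall>x\<in>U. \<forall>\<^sub>F (x', y) in uniformity. x' = x \<longrightarrow> y \<in> U)" for U :: "'a L2 set"
    by (fact open_L2_def)
  show "inner x y = inner y x"
    by transfer (simp add: inner_commute)
  show "inner (x + y) z = inner x z + inner y z"
    by transfer (simp add: inner_add_left square_integrable_inner)
  show "inner (r *\<^sub>R x) y = r * inner x y"
    by transfer simp
  show "0 \<le> inner x x"
    by transfer simp
  show "inner x x = 0 \<longleftrightarrow> x = 0"
    by transfer
      (auto simp: integral_nonneg_eq_0_iff_AE square_integrable_inner square_integrable_zero)
  show "norm x = sqrt (inner x x)"
    by (fact norm_L2_def)
qed

end

lemma square_integrable_rep_L2: "square_integrable (lebesgue_on {0..1}) (rep_L2 x)"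
  using Quotient_rep_reflp[OF Quotient_L2] by blast

lemma abs_rep_L2: "abs_L2 (rep_L2 x) = x"
  by (rule Quotient_abs_rep[OF Quotient_L2])

lemma norm_abs_L2_diff:
  assumes "square_integrable (lebesgue_on {0..1}) f" "square_integrable (lebesgue_on {0..1}) g"
  shows "(norm (abs_L2 f - abs_L2 g))\<^sup>2 = (LINT s|lebesgue_on {0..1}. (norm (f s - g s))\<^sup>2)"
proof -
  have "abs_L2 f - abs_L2 g = abs_L2 (\<lambda>s. f s + (- 1) *\<^sub>R g s)"
    unfolding minus_L2_def using assms
    by (simp add: plus_L2.abs_eq scaleR_L2.abs_eq square_integrable_scaleR
        del: scaleR_minus_left scaleR_minus1_left)
  moreover have "square_integrable (lebesgue_on {0..1}) (\<lambda>s. f s + (- 1) *\<^sub>R g s)"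
    by (intro square_integrable_add square_integrable_scaleR assms)
  ultimately show ?thesis
    by (simp add: power2_norm_eq_inner inner_L2.abs_eq)
qed

instance L2 :: (finite) banach
proof
  fix X :: "nat \<Rightarrow> 'a L2"
  assume X: "Cauchy X"
  define M where "M = lebesgue_on {0..1::real}"
  define F where "F n = rep_L2 (X n)" for n
  interpret finite_measure M
    unfolding M_def by (intro finite_measure_lebesgue_on) simp
  have M1: "measure M (space M) = 1"
    by (simp add: M_def measure_restrict_space)
  have F: "square_integrable M (F n)" for n
    by (simp add: F_def M_def square_integrable_rep_L2)
  have F_meas [measurable]: "F n \<in> borel_measurable M" for n
    using F[of n] by (simp add: square_integrable_def)
  have F_diff: "square_integrable M (\<lambda>s. F i s - F j s)" for i j
    using square_integrable_add[OF F[of i] square_integrable_scaleR[OF F[of j], of "-1"]] by simp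
  have F_diff_int: "integrable M (\<lambda>s. (norm (F i s - F j s))\<^sup>2)" for i j
    using F_diff[of i j] by (simp add: square_integrable_def)
  have F_int: "integrable M (F n)" for n
  proof -
    have "integrable M (\<lambda>s. (norm (F n s))\<^sup>2)"
      using F[of n] by (simp add: square_integrable_def)
    then have "integrable M (\<lambda>s. norm (F n s))"
      by (rule square_integrable_imp_integrable[rotated]) auto
    then show ?thesis by (simp add: integrable_norm_iff)
  qed
  have dist_X: "(dist (X i) (X j))\<^sup>2 = (LINT s|M. (norm (F i s - F j s))\<^sup>2)" for i j
    using norm_abs_L2_diff[OF square_integrable_rep_L2[of "X i"] square_integrable_rep_L2[of "X j"]]
    by (simp add: abs_rep_L2 dist_norm F_def M_def)
  have ex: "\<exists>N. \<forall>i\<ge>N. \<forall>j\<ge>N. (LINT s|M. norm (F i s - F j s)) < e" if e: "e > 0" for e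
  proof -
    obtain N where N: "\<And>i j. i \<ge> N \<Longrightarrow> j \<ge> N \<Longrightarrow> dist (X i) (X j) < e"
      using X e unfolding Cauchy_def by blast
    have "(LINT s|M. norm (F i s - F j s)) < e" if "i \<ge> N" "j \<ge> N" for i j
    proof -
      have am: "norm (F i s - F j s) \<le> ((norm (F i s - F j s))\<^sup>2 / e + e) / 2" for s
        using e sum_squares_bound[of "norm (F i s - F j s)" e]
        by (simp add: field_simps power2_eq_square)
      have "(LINT s|M. norm (F i s - F j s))
          \<le> (LINT s|M. ((norm (F i s - F j s))\<^sup>2 / e + e) / 2)"
        by (intro integral_mono) (use F_int F_diff_int am in auto)
      also have "\<dots> = ((dist (X i) (X j))\<^sup>2 / e + e) / 2"
        by (subst integral_divide_zero, subst Bochner_Integration.integral_add)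
          (use F_diff_int M1 dist_X in auto)
      also have "\<dots> < (e\<^sup>2 / e + e) / 2"
        using N[OF that] e by (intro divide_strict_right_mono add_strict_right_mono power_strict_mono) auto
      also have "\<dots> = e"
        using e by (simp add: power2_eq_square)
      finally show ?thesis .
    qed
    then show ?thesis by blast
  qed
  obtain r where r: "strict_mono r" "AE s in M. Cauchy (\<lambda>i. F (r i) s)"
    using cauchy_L1_AE_cauchy_subseq[OF F_int ex] by blast
  define f where "f s = lim (\<lambda>i. F (r i) s)" for s
  have f_meas [measurable]: "f \<in> borel_measurable M"
    unfolding f_def by measurable
  have lim: "AE s in M. (\<lambda>i. F (r i) s) \<longlonglongrightarrow> f s"
    using r(2) by eventually_elim (simp add: f_def Cauchy_convergent_iff convergent_LIMSEQ_iff)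
  have bound: "\<exists>N. \<forall>n\<ge>N. (\<integral>\<^sup>+s. ennreal ((norm (f s - F n s))\<^sup>2) \<partial>M) \<le> ennreal (e\<^sup>2)"
    if e: "e > 0" for e
  proof -
    obtain N where N: "\<And>i j. i \<ge> N \<Longrightarrow> j \<ge> N \<Longrightarrow> dist (X i) (X j) < e"
      using X e unfolding Cauchy_def by blast
    have "(\<integral>\<^sup>+s. ennreal ((norm (f s - F n s))\<^sup>2) \<partial>M) \<le> ennreal (e\<^sup>2)" if n: "n \<ge> N" for n
    proof -
      have "AE s in M. ennreal ((norm (f s - F n s))\<^sup>2)
          = liminf (\<lambda>i. ennreal ((norm (F (r i) s - F n s))\<^sup>2))"
        using lim
      proof eventually_elim
        case (elim s)
        then have "(\<lambda>i. ennreal ((norm (F (r i) s - F n s))\<^sup>2)) \<longlonglongrightarrow> ennreal ((norm (f s - F n s))\<^sup>2)"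
          by (intro tendsto_intros)
        from lim_imp_Liminf[OF sequentially_bot this] show ?case
          by (rule sym)
      qed
      then have "(\<integral>\<^sup>+s. ennreal ((norm (f s - F n s))\<^sup>2) \<partial>M)
          = (\<integral>\<^sup>+s. liminf (\<lambda>i. ennreal ((norm (F (r i) s - F n s))\<^sup>2)) \<partial>M)"
        by (rule nn_integral_cong_AE)
      also have "\<dots> \<le> liminf (\<lambda>i. \<integral>\<^sup>+s. ennreal ((norm (F (r i) s - F n s))\<^sup>2) \<partial>M)"
        by (rule nn_integral_liminf) measurable
      also have "\<dots> = liminf (\<lambda>i. ennreal ((dist (X (r i)) (X n))\<^sup>2))"
        by (simp add: nn_integral_eq_integral F_diff_int dist_X)
      also have "\<dots> \<le> ennreal (e\<^sup>2)"
      proof (rule order_trans[OF Liminf_le_Limsup Limsup_bounded])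
        have "dist (X (r i)) (X n) < e" if "i \<ge> N" for i
          using seq_suble[OF r(1), of i] that n by (intro N) linarith+
        then show "\<forall>\<^sub>F i in sequentially. ennreal ((dist (X (r i)) (X n))\<^sup>2) \<le> ennreal (e\<^sup>2)"
          by (intro eventually_sequentiallyI[of N] ennreal_leI power_mono less_imp_le zero_le_dist)
      qed simp
      finally show ?thesis .
    qed
    then show ?thesis by blast
  qed
  have diff_int: "integrable M (\<lambda>s. (norm (f s - F n s))\<^sup>2)"
    if "(\<integral>\<^sup>+s. ennreal ((norm (f s - F n s))\<^sup>2) \<partial>M) \<le> ennreal c" for n c
    using that by (intro integrableI_bounded) (auto intro: le_less_trans)
  have f: "square_integrable M f"
  proof -
    obtain n where "(\<integral>\<^sup>+s. ennreal ((norm (f s - F n s))\<^sup>2) \<partial>M) \<le> ennreal (1\<^sup>2)"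
      using bound[OF zero_less_one] by blast
    from diff_int[OF this] have "square_integrable M (\<lambda>s. f s - F n s)"
      by (simp add: square_integrable_def)
    from square_integrable_add[OF this F[of n]] show ?thesis by simp
  qed
  have "X \<longlonglongrightarrow> abs_L2 f"
  proof (rule metric_LIMSEQ_I)
    fix e :: real
    assume e: "e > 0"
    then obtain N where N: "\<And>n. n \<ge> N \<Longrightarrow>
        (\<integral>\<^sup>+s. ennreal ((norm (f s - F n s))\<^sup>2) \<partial>M) \<le> ennreal ((e / 2)\<^sup>2)"
      using bound[OF half_gt_zero] by blast
    have "dist (X n) (abs_L2 f) < e" if n: "n \<ge> N" for n
    proof -
      have "(dist (abs_L2 f) (X n))\<^sup>2 = (LINT s|M. (norm (f s - F n s))\<^sup>2)"
        using norm_abs_L2_diff[of f "rep_L2 (X n)"] f square_integrable_rep_L2[of "X n"]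
        by (simp add: abs_rep_L2 dist_norm F_def M_def)
      also have "\<dots> \<le> (e / 2)\<^sup>2"
        using N[OF n] diff_int[OF N[OF n]] by (simp add: nn_integral_eq_integral)
      finally have "dist (abs_L2 f) (X n) \<le> e / 2"
        by (rule power2_le_imp_le) (use e in simp)
      then show ?thesis using e by (simp add: dist_commute)
    qed
    then show "\<exists>N. \<forall>n\<ge>N. dist (X n) (abs_L2 f) < e" by blast
  qed
  then show "convergent X" by (rule convergentI)
qed

lemma Riesz_representation:
  fixes f :: "'a::{real_inner, banach} \<Rightarrow> real"
  assumes f: "bounded_linear f"
  shows "\<exists>z. \<forall>x. f x = x \<bullet> z"
proof -
  interpret f: bounded_linear f by (fact f)
  define J where "J x = x \<bullet> x - 2 * f x" for x
  obtain K where K: "\<And>x. \<bar>f x\<bar> \<le> norm x * K"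
    using f.bounded by auto
  have J_lower: "- K\<^sup>2 \<le> J x" for x
  proof -
    have "2 * f x \<le> 2 * (norm x * K)" using K[of x] by linarith
    also have "\<dots> \<le> (norm x)\<^sup>2 + K\<^sup>2" using sum_squares_bound[of "norm x" K] by simp
    finally show ?thesis by (simp add: J_def power2_norm_eq_inner)
  qed
  define m where "m = Inf (range J)"
  have bdd: "bdd_below (range J)"
    using J_lower by (intro bdd_belowI[of _ "- K\<^sup>2"]) auto
  have m_le: "m \<le> J x" for x
    unfolding m_def by (rule cInf_lower[OF _ bdd]) simp
  have "\<exists>x. J x < m + inverse (real (Suc n))" for n
    using cInf_lessD[of "range J" "m + inverse (real (Suc n))"] by (auto simp: m_def)
  then obtain X where X: "\<And>n. J (X n) < m + inverse (real (Suc n))" by metis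
  have par: "(norm (x - y))\<^sup>2 \<le> 2 * (J x - m) + 2 * (J y - m)" for x y
  proof -
    define w where "w = (1/2) *\<^sub>R (x + y)"
    have "(norm (x - y))\<^sup>2 = 2 * J x + 2 * J y - 4 * J w"
      by (simp add: J_def w_def power2_norm_eq_inner inner_simps f.add f.scaleR inner_commute
          field_simps)
    also have "\<dots> \<le> 2 * J x + 2 * J y - 4 * m"
      using m_le[of w] by simp
    finally show ?thesis by simp
  qed
  have "Cauchy X"
  proof (rule metric_CauchyI)
    fix e :: real
    assume e: "e > 0"
    then obtain N where N: "inverse (real (Suc N)) < e\<^sup>2 / 4"
      using reals_Archimedean[of "e\<^sup>2 / 4"] by auto
    have small: "J (X n) - m < e\<^sup>2 / 4" if "n \<ge> N" for n
    proof -
      have "inverse (real (Suc n)) \<le> inverse (real (Suc N))"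
        using that by (intro le_imp_inverse_le) auto
      with X[of n] N show ?thesis by linarith
    qed
    have "dist (X i) (X j) < e" if "i \<ge> N" "j \<ge> N" for i j
    proof -
      note par[of "X i" "X j"]
      also have "2 * (J (X i) - m) + 2 * (J (X j) - m) < e\<^sup>2"
        using small[OF that(1)] small[OF that(2)] by simp
      finally have "(norm (X i - X j))\<^sup>2 < e\<^sup>2" .
      then show ?thesis
        using e by (auto simp: dist_norm intro: power2_less_imp_less)
    qed
    then show "\<exists>N. \<forall>i\<ge>N. \<forall>j\<ge>N. dist (X i) (X j) < e" by blast
  qed
  then obtain z where z: "X \<longlonglongrightarrow> z"
    using Cauchy_convergent_iff convergent_def by blast
  have "(\<lambda>n. J (X n)) \<longlonglongrightarrow> J z"
    unfolding J_def by (intro tendsto_intros f.tendsto z)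
  moreover have "(\<lambda>n. m + inverse (real (Suc n))) \<longlonglongrightarrow> m + 0"
    by (intro tendsto_intros LIMSEQ_inverse_real_of_nat)
  ultimately have "J z \<le> m + 0"
    by (rule LIMSEQ_le) (use X less_imp_le in blast)
  then have min: "J z \<le> J x" for x using m_le[of x] by linarith
  have "f x = x \<bullet> z" for x
  proof (rule ccontr)
    assume ne: "f x \<noteq> x \<bullet> z"
    define c where "c = x \<bullet> z - f x"
    define q where "q = 1 + x \<bullet> x"
    have q: "q > 0" by (simp add: q_def add_pos_nonneg)
    have c: "c\<^sup>2 > 0" using ne by (simp add: c_def)
    have xx: "x \<bullet> x = q - 1" by (simp add: q_def)
    have J_line: "J (z + t *\<^sub>R x) = J z + t\<^sup>2 * (x \<bullet> x) + 2 * t * c" for t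
      by (simp add: J_def c_def inner_simps f.add f.scaleR inner_commute power2_eq_square
          algebra_simps)
    have "J (z + (- c / q) *\<^sub>R x) = J z + (c / q)\<^sup>2 * (x \<bullet> x) - 2 * (c / q) * c"
      unfolding J_line by (simp add: power2_eq_square)
    also have "\<dots> = J z - c\<^sup>2 / q\<^sup>2 * (q + 1)"
      using q unfolding xx by (simp add: field_simps power2_eq_square)
    also have "\<dots> < J z"
      using q c by simp
    finally show False using min[of "z + (- c / q) *\<^sub>R x"] by linarith
  qed
  then show ?thesis by blast
qed

text \<open>The constant \<^const>\<open>adjoint\<close> picks some function satisfying the adjoint equation;
  on a Hilbert space it exists, is unique and is bounded, so it can be wrapped as a bounded
  operator.\<close>

definition adjoint_blinfun ::
    "('a::{real_inner, banach} \<Rightarrow>\<^sub>L 'b::{real_inner, banach}) \<Rightarrow> 'b \<Rightarrow>\<^sub>L 'a" where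
  "adjoint_blinfun P = Blinfun (adjoint (blinfun_apply P))"

lemma inner_adjoint_blinfun:
  fixes P :: "'a::{real_inner, banach} \<Rightarrow>\<^sub>L 'b::{real_inner, banach}"
  shows "P x \<bullet> y = x \<bullet> adjoint_blinfun P y"
proof -
  have "\<exists>w. \<forall>x. P x \<bullet> y = x \<bullet> w" for y
    by (rule Riesz_representation)
      (intro bounded_linear_intros)
  then obtain g where g: "\<And>x y. P x \<bullet> y = x \<bullet> g y" by metis
  have adj: "adjoint (blinfun_apply P) = g"
    by (rule adjoint_unique) (simp add: g)
  have "bounded_linear g"
  proof (rule bounded_linear_intro)
    show "g (y + z) = g y + g z" for y z
      by (rule vector_eq_rdot[THEN iffD1]) (metis g inner_add_right inner_commute)
    show "g (c *\<^sub>R y) = c *\<^sub>R g y" for c y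
      by (rule vector_eq_rdot[THEN iffD1]) (metis g inner_scaleR_right inner_commute)
    show "norm (g y) \<le> norm y * norm P" for y
    proof (cases "g y = 0")
      case False
      have "norm (g y) * norm (g y) = P (g y) \<bullet> y"
        by (simp add: g power2_norm_eq_inner flip: power2_eq_square)
      also have "\<dots> \<le> norm (P (g y)) * norm y"
        by (rule norm_cauchy_schwarz)
      also have "\<dots> \<le> norm P * norm (g y) * norm y"
        by (intro mult_right_mono norm_blinfun) simp
      finally show ?thesis using False by (simp add: mult.commute mult.left_commute)
    qed simp
  qed
  then show ?thesis
    by (simp add: adjoint_blinfun_def adj bounded_linear_Blinfun_apply g)
qed

definition op_le :: "('a::real_inner \<Rightarrow>\<^sub>L 'a) \<Rightarrow> ('a \<Rightarrow>\<^sub>L 'a) \<Rightarrow> bool" (infix \<open>\<preceq>\<close> 50) where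
  "M \<preceq> N \<longleftrightarrow> (\<forall>x. x \<bullet> M x \<le> x \<bullet> N x)"

definition essentially_bounded :: "'a measure \<Rightarrow> ('a \<Rightarrow> 'b::real_normed_vector) \<Rightarrow> bool" where
  "essentially_bounded M f \<longleftrightarrow> f \<in> borel_measurable M \<and> (\<exists>B. AE s in M. norm (f s) \<le> B)"

text \<open>The two integrands are integrable for almost every \<open>s\<close> only, which is all that an
  almost-everywhere identity between representatives needs. The defining property does not depend
  on the representatives chosen by \<^const>\<open>rep_L2\<close>.\<close>

definition PI_operators :: "('m::finite L2 \<Rightarrow>\<^sub>L 'm L2) set" (\<open>\<Pi>\<^sub>3\<close>) where
  "\<Pi>\<^sub>3 = {P :: 'm L2 \<Rightarrow>\<^sub>L 'm L2. \<exists>(R0 :: real \<Rightarrow> real ^ 'm ^ 'm) (R1 :: real \<times> real \<Rightarrow> real ^ 'm ^ 'm)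
        (R2 :: real \<times> real \<Rightarrow> real ^ 'm ^ 'm).
      essentially_bounded (lebesgue_on {0..1}) R0 \<and>
      square_integrable (lebesgue_on ({0..1} \<times> {0..1})) R1 \<and>
      square_integrable (lebesgue_on ({0..1} \<times> {0..1})) R2 \<and>
      (\<forall>x. AE s in lebesgue_on {0..1}.
        rep_L2 (P x) s = R0 s *v rep_L2 x s
          + (LINT \<theta>|lebesgue_on {0..s}. R1 (s, \<theta>) *v rep_L2 x \<theta>)
          + (LINT \<theta>|lebesgue_on {s..1}. R2 (s, \<theta>) *v rep_L2 x \<theta>))}"

definition PIE_solution ::
    "('a::real_normed_vector \<Rightarrow>\<^sub>L 'a) \<Rightarrow> ('a \<Rightarrow>\<^sub>L 'a) \<Rightarrow> (real \<Rightarrow> 'a) \<Rightarrow> bool" where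
  "PIE_solution T A x \<longleftrightarrow>
     (\<exists>x'. \<forall>t\<ge>0. (x has_vector_derivative x' t) (at t within {0..}) \<and> T (x' t) = A (x t))"

text \<open>The Bochner integral of a non-integrable function is 0 by convention, so finiteness of the
  energy has to be required explicitly.\<close>

definition energy_bound :: "(real \<Rightarrow> 'a::real_normed_vector) \<Rightarrow> real \<Rightarrow> bool" where
  "energy_bound y b \<longleftrightarrow>
     set_integrable lborel {0..} (\<lambda>t. (norm (y t))\<^sup>2) \<and>
     sqrt (LBINT t:{0..}. (norm (y t))\<^sup>2) \<le> b"

definition FE_PIE_to_PDE_stable ::
    "('a::real_normed_vector \<Rightarrow>\<^sub>L 'a) \<Rightarrow> ('a \<Rightarrow>\<^sub>L 'a) \<Rightarrow> bool" where
  "FE_PIE_to_PDE_stable T A \<longleftrightarrow>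
     (\<exists>C>0. \<forall>x. PIE_solution T A x \<longrightarrow> energy_bound (\<lambda>t. T (x t)) (C * norm (x 0)))"

definition FE_PIE_stable ::
    "('a::real_normed_vector \<Rightarrow>\<^sub>L 'a) \<Rightarrow> ('a \<Rightarrow>\<^sub>L 'a) \<Rightarrow> bool" where
  "FE_PIE_stable T A \<longleftrightarrow>
     (\<exists>C>0. \<forall>x. PIE_solution T A x \<longrightarrow> energy_bound x (C * norm (x 0)))"

definition FE_PDE_stable ::
    "('a::real_normed_vector \<Rightarrow>\<^sub>L 'a) \<Rightarrow> ('a \<Rightarrow>\<^sub>L 'a) \<Rightarrow> bool" where
  "FE_PDE_stable T A \<longleftrightarrow>
     (\<exists>C>0. \<forall>x. PIE_solution T A x \<longrightarrow> energy_bound (\<lambda>t. T (x t)) (C * norm (T (x 0))))"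

definition FE_PDE_to_PIE_stable ::
    "('a::real_normed_vector \<Rightarrow>\<^sub>L 'a) \<Rightarrow> ('a \<Rightarrow>\<^sub>L 'a) \<Rightarrow> bool" where
  "FE_PDE_to_PIE_stable T A \<longleftrightarrow>
     (\<exists>C>0. \<forall>x. PIE_solution T A x \<longrightarrow> energy_bound x (C * norm (T (x 0))))"

end

theory Submission
  imports Defs
begin

text \<open>
  All four implications are one Lyapunov argument. Put \<open>V(t) = \<langle>x(t), Q T x(t)\<rangle>\<close> along a solution.
  Symmetry of \<open>Q T\<close> is what makes the derivative \<open>x'\<close> enter only through \<open>T x'\<close>, so that the
  equation applies: \<open>V' = 2 \<langle>x, Q T x'\<rangle> = 2 \<langle>x, Q A x\<rangle> = \<langle>x, (Q A + A\<^sup>* Q\<^sup>*) x\<rangle>\<close>. If this is at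
  most \<open>-\<alpha> \<parallel>Y x\<parallel>\<^sup>2\<close>, then integrating and discarding \<open>V \<ge> 0\<close> at the right end point gives
  \<open>\<alpha> \<integral> \<parallel>Y x\<parallel>\<^sup>2 \<le> V(0)\<close> on every bounded time interval, hence on the half-line. A bound
  \<open>V(0) \<le> c \<parallel>B x(0)\<parallel>\<^sup>2\<close> finishes the estimate. This is the lemma \<open>Lyapunov_energy_estimate\<close>.

  The four notions differ only in the observed output \<open>Y\<close> and the measure \<open>B\<close> of the initial state,
  each of which is \<open>I\<close> or \<open>T\<close>. For \<open>B = I\<close> the bound on \<open>V(0)\<close> is boundedness of \<open>Q T\<close>. For
  \<open>B = T\<close> it is the additional hypothesis \<open>Q T \<le> C T\<^sup>* T\<close>, or it comes for free from the form
  \<open>Q = T\<^sup>* P\<close>, because then \<open>V = \<langle>T x, P T x\<rangle>\<close>.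
\<close>

section \<open>Integrating a dissipation inequality\<close>

text \<open>Since \<open>V\<close> stays nonnegative, it can decrease by at most \<open>V 0\<close> over \<open>[0, n]\<close>, and this decrease
  dominates \<open>\<alpha>\<close> times the integral of \<open>f\<close>. The integrals of \<open>f\<close> over \<open>[0, n]\<close> are therefore bounded uniformly in \<open>n\<close>, and
  monotone convergence produces integrability on the half-line along with the bound.\<close>

lemma dissipation_integral_bound:
  fixes V V' f :: "real \<Rightarrow> real"
  assumes V': "\<And>t. t \<ge> 0 \<Longrightarrow> (V has_real_derivative V' t) (at t within {0..})"
    and V_nonneg: "\<And>t. t \<ge> 0 \<Longrightarrow> V t \<ge> 0"
    and f_cont: "continuous_on {0..} f"
    and f_nonneg: "\<And>t. t \<ge> 0 \<Longrightarrow> f t \<ge> 0"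
    and dissipation: "\<And>t. t \<ge> 0 \<Longrightarrow> V' t \<le> - \<alpha> * f t"
    and "\<alpha> > 0"
  shows "set_integrable lborel {0..} f" "(LBINT t:{0..}. f t) \<le> V 0 / \<alpha>"
proof -
  define g where "g n t = indicator {0..real n} t *\<^sub>R f t" for n t
  define u where "u t = indicator {0..} t *\<^sub>R f t" for t
  have f_int: "set_integrable lborel {0..real n} f" for n
    by (rule borel_integrable_atLeastAtMost') (rule continuous_on_subset[OF f_cont], auto)
  then have g_int: "integrable lborel (g n)" for n
    by (simp add: g_def[abs_def] set_integrable_def)
  have g_bound: "(LINT t|lborel. g n t) \<le> V 0 / \<alpha>" for n
  proof -
    have "(f has_integral (LBINT t:{0..real n}. f t)) {0..real n}"
      using set_borel_integral_eq_integral[OF f_int] by (simp add: has_integral_integral)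
    then have dis: "((\<lambda>t. - \<alpha> * f t) has_integral - \<alpha> * (LBINT t:{0..real n}. f t)) {0..real n}"
      by (rule has_integral_mult_right)
    have "(V' has_integral V (real n) - V 0) {0..real n}"
    proof (rule fundamental_theorem_of_calculus)
      fix t :: real
      assume "t \<in> {0..real n}"
      then have "(V has_real_derivative V' t) (at t within {0..real n})"
        by (intro DERIV_subset[OF V']) auto
      then show "(V has_vector_derivative V' t) (at t within {0..real n})"
        by (simp add: has_real_derivative_iff_has_vector_derivative)
    qed simp
    then have "V (real n) - V 0 \<le> - \<alpha> * (LBINT t:{0..real n}. f t)"
      by (rule has_integral_le[OF _ dis]) (rule dissipation, simp)
    with V_nonneg[of "real n"] have "\<alpha> * (LBINT t:{0..real n}. f t) \<le> V 0"
      by linarith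
    then show ?thesis
      using \<open>\<alpha> > 0\<close> by (simp add: g_def set_lebesgue_integral_def pos_le_divide_eq mult.commute)
  qed
  have g_mono: "mono (\<lambda>n. g n t)" for t
    unfolding g_def by (rule monoI) (auto simp: indicator_def f_nonneg)
  have g_lim: "(\<lambda>n. g n t) \<longlonglongrightarrow> u t" for t
  proof (rule tendsto_eventually)
    obtain N where "t \<le> real N"
      using real_arch_simple by blast
    then show "\<forall>\<^sub>F n in sequentially. g n t = u t"
      by (intro eventually_sequentiallyI[of N]) (auto simp: g_def u_def indicator_def)
  qed
  have u_meas: "u \<in> borel_measurable lborel"
    by (rule borel_measurable_LIMSEQ_real[OF g_lim]) (use g_int in blast)
  have "incseq (\<lambda>n. LINT t|lborel. g n t)"
    unfolding incseq_def by (intro allI impI integral_mono g_int) (rule monoD[OF g_mono])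
  then obtain l where l: "(\<lambda>n. LINT t|lborel. g n t) \<longlonglongrightarrow> l"
    by (rule incseq_convergent) (use g_bound in blast)
  have l_le: "l \<le> V 0 / \<alpha>"
    by (rule LIMSEQ_le_const2[OF l]) (use g_bound in blast)
  have mc: "integrable lborel u" "integral\<^sup>L lborel u = l"
    by (rule integrable_monotone_convergence integral_monotone_convergence,
        (rule g_int AE_I2 g_mono g_lim l u_meas)+)+
  show "set_integrable lborel {0..} f"
    using mc(1) by (simp add: u_def[abs_def] set_integrable_def)
  show "(LBINT t:{0..}. f t) \<le> V 0 / \<alpha>"
    using mc(2) l_le by (simp add: u_def[abs_def] set_lebesgue_integral_def)
qed

section \<open>The Lyapunov estimate\<close>

text \<open>The inequality \<open>dissipative\<close> is the operator inequality for \<open>Q A + A\<^sup>* Q\<^sup>*\<close> as a quadratic form,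
  which sees only twice the form of \<open>Q A\<close>. The output \<open>Y\<close> and the measure \<open>B\<close> of the initial state
  are kept apart because each of the four stability notions is a different choice of the pair.\<close>

lemma Lyapunov_energy_estimate:
  fixes T A Q :: "'a::real_inner \<Rightarrow>\<^sub>L 'a"
    and Y :: "'a \<Rightarrow>\<^sub>L 'b::real_normed_vector" and B :: "'a \<Rightarrow>\<^sub>L 'c::real_normed_vector"
  assumes sym: "\<And>u v. u \<bullet> Q (T v) = Q (T u) \<bullet> v"
    and nonneg: "\<And>u. u \<bullet> Q (T u) \<ge> 0"
    and bound: "\<And>u. u \<bullet> Q (T u) \<le> c * (norm (B u))\<^sup>2"
    and dissipative: "\<And>u. 2 * (u \<bullet> Q (A u)) \<le> - \<alpha> * (norm (Y u))\<^sup>2"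
    and "c > 0" "\<alpha> > 0"
  shows "\<exists>C>0. \<forall>x. PIE_solution T A x \<longrightarrow> energy_bound (\<lambda>t. Y (x t)) (C * norm (B (x 0)))"
proof (intro exI[of _ "sqrt (c / \<alpha>)"] conjI allI impI)
  show "sqrt (c / \<alpha>) > 0"
    using \<open>c > 0\<close> \<open>\<alpha> > 0\<close> by simp
next
  fix x
  assume "PIE_solution T A x"
  then obtain x' where
    x': "\<And>t. t \<ge> 0 \<Longrightarrow> (x has_vector_derivative x' t) (at t within {0..})" and
    eq: "\<And>t. t \<ge> 0 \<Longrightarrow> T (x' t) = A (x t)"
    unfolding PIE_solution_def by blast
  define V where "V t = x t \<bullet> Q (T (x t))" for t
  have V': "(V has_real_derivative 2 * (x t \<bullet> Q (A (x t)))) (at t within {0..})"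
    if "t \<ge> 0" for t
  proof -
    have "((\<lambda>t. Q (T (x t))) has_vector_derivative Q (T (x' t))) (at t within {0..})"
      by (intro bounded_linear.has_vector_derivative[OF blinfun.bounded_linear_right] x' that)
    from bounded_bilinear.has_vector_derivative[OF bounded_bilinear_inner x'[OF that] this]
    have "(V has_vector_derivative x t \<bullet> Q (T (x' t)) + x' t \<bullet> Q (T (x t))) (at t within {0..})"
      by (simp add: V_def[abs_def])
    moreover have "x' t \<bullet> Q (T (x t)) = x t \<bullet> Q (T (x' t))"
      by (metis sym inner_commute)
    ultimately show ?thesis
      by (simp add: eq that has_real_derivative_iff_has_vector_derivative)
  qed
  have "continuous_on {0..} x"
    unfolding continuous_on_eq_continuous_within
    using has_vector_derivative_continuous[OF x'] by simp
  then have Y_cont: "continuous_on {0..} (\<lambda>t. (norm (Y (x t)))\<^sup>2)"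
    by (intro continuous_intros)
  note est = dissipation_integral_bound[OF V' _ Y_cont _ dissipative \<open>\<alpha> > 0\<close>]
  have "(LBINT t:{0..}. (norm (Y (x t)))\<^sup>2) \<le> V 0 / \<alpha>"
    by (rule est(2)) (auto simp: V_def nonneg)
  also have "\<dots> \<le> c / \<alpha> * (norm (B (x 0)))\<^sup>2"
    using bound[of "x 0"] \<open>\<alpha> > 0\<close> by (simp add: V_def divide_right_mono)
  finally have "sqrt (LBINT t:{0..}. (norm (Y (x t)))\<^sup>2) \<le> sqrt (c / \<alpha> * (norm (B (x 0)))\<^sup>2)"
    by (rule real_sqrt_le_mono)
  then have "sqrt (LBINT t:{0..}. (norm (Y (x t)))\<^sup>2) \<le> sqrt (c / \<alpha>) * norm (B (x 0))"
    unfolding real_sqrt_mult real_sqrt_abs abs_norm_cancel .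
  moreover have "set_integrable lborel {0..} (\<lambda>t. (norm (Y (x t)))\<^sup>2)"
    by (rule est(1)) (auto simp: V_def nonneg)
  ultimately show "energy_bound (\<lambda>t. Y (x t)) (sqrt (c / \<alpha>) * norm (B (x 0)))"
    by (simp add: energy_bound_def)
qed

section \<open>Operator inequalities as quadratic forms\<close>

lemma inner_adjoint_blinfun_left:
  fixes P :: "'a::{real_inner, banach} \<Rightarrow>\<^sub>L 'b::{real_inner, banach}"
  shows "adjoint_blinfun P y \<bullet> x = y \<bullet> P x"
  by (metis inner_adjoint_blinfun inner_commute)

lemma self_adjoint_blinfun_sym:
  fixes S :: "'a::{real_inner, banach} \<Rightarrow>\<^sub>L 'a"
  assumes "S = adjoint_blinfun S"
  shows "u \<bullet> S v = S u \<bullet> v"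
  by (metis assms inner_adjoint_blinfun)

lemma inner_self_add_adjoint:
  fixes Q A :: "'a::{real_inner, banach} \<Rightarrow>\<^sub>L 'a"
  shows "u \<bullet> ((Q o\<^sub>L A) + (adjoint_blinfun A o\<^sub>L adjoint_blinfun Q)) u = 2 * (u \<bullet> Q (A u))"
  by (simp add: blinfun.add_left inner_add_right inner_commute[of "Q (A u)"]
      flip: inner_adjoint_blinfun)

lemma inner_adjoint_self:
  fixes T :: "'a::{real_inner, banach} \<Rightarrow>\<^sub>L 'b::{real_inner, banach}"
  shows "u \<bullet> adjoint_blinfun T (T u) = (norm (T u))\<^sup>2"
  by (simp add: power2_norm_eq_inner flip: inner_adjoint_blinfun)

text \<open>The summand \<open>1\<close> makes the constant strictly positive even for the zero operator, as a
  stability constant has to be.\<close>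

lemma inner_blinfun_self_le:
  fixes S :: "'a::real_inner \<Rightarrow>\<^sub>L 'a"
  shows "u \<bullet> S u \<le> (norm S + 1) * (norm u)\<^sup>2"
proof -
  have "u \<bullet> S u \<le> norm u * norm (S u)"
    by (rule norm_cauchy_schwarz)
  also have "\<dots> \<le> norm u * (norm S * norm u)"
    by (intro mult_left_mono norm_blinfun) simp
  also have "\<dots> \<le> (norm S + 1) * (norm u)\<^sup>2"
    by (simp add: power2_eq_square algebra_simps)
  finally show ?thesis .
qed

section \<open>The four stability criteria\<close>

theorem lemma9:
  fixes T A :: "'m::finite L2 \<Rightarrow>\<^sub>L 'm L2"
  assumes "T \<in> \<Pi>\<^sub>3" and "A \<in> \<Pi>\<^sub>3"
  shows
    "((\<exists>Q\<in>\<Pi>\<^sub>3. \<exists>\<alpha>>0.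
         (Q o\<^sub>L T) = adjoint_blinfun (Q o\<^sub>L T) \<and> 0 \<preceq> (Q o\<^sub>L T) \<and>
         (Q o\<^sub>L A) + (adjoint_blinfun A o\<^sub>L adjoint_blinfun Q)
           \<preceq> - \<alpha> *\<^sub>R (adjoint_blinfun T o\<^sub>L T))
       \<longrightarrow> FE_PIE_to_PDE_stable T A) \<and>
     ((\<exists>Q\<in>\<Pi>\<^sub>3. \<exists>\<alpha>>0.
         (Q o\<^sub>L T) = adjoint_blinfun (Q o\<^sub>L T) \<and> 0 \<preceq> (Q o\<^sub>L T) \<and>
         (Q o\<^sub>L A) + (adjoint_blinfun A o\<^sub>L adjoint_blinfun Q) \<preceq> - \<alpha> *\<^sub>R id_blinfun)
       \<longrightarrow> FE_PIE_stable T A) \<and>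
     ((\<exists>P\<in>\<Pi>\<^sub>3. \<exists>\<alpha>>0.
         P = adjoint_blinfun P \<and> 0 \<preceq> P \<and>
         (adjoint_blinfun T o\<^sub>L P o\<^sub>L A) + (adjoint_blinfun A o\<^sub>L P o\<^sub>L T)
           \<preceq> - \<alpha> *\<^sub>R (adjoint_blinfun T o\<^sub>L T))
       \<longrightarrow> FE_PDE_stable T A) \<and>
     ((\<exists>Q\<in>\<Pi>\<^sub>3. \<exists>C>0. \<exists>\<alpha>>0.
         (Q o\<^sub>L T) = adjoint_blinfun (Q o\<^sub>L T) \<and> 0 \<preceq> (Q o\<^sub>L T) \<and>
         (Q o\<^sub>L T) \<preceq> C *\<^sub>R (adjoint_blinfun T o\<^sub>L T) \<and>
         (Q o\<^sub>L A) + (adjoint_blinfun A o\<^sub>L adjoint_blinfun Q) \<preceq> - \<alpha> *\<^sub>R id_blinfun)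
       \<longrightarrow> FE_PDE_to_PIE_stable T A)"
proof (intro conjI impI; elim bexE exE conjE)
  fix Q :: "'m L2 \<Rightarrow>\<^sub>L 'm L2" and \<alpha> :: real
  assume QT: "(Q o\<^sub>L T) = adjoint_blinfun (Q o\<^sub>L T)" "0 \<preceq> (Q o\<^sub>L T)" and "\<alpha> > 0"
    and dis: "(Q o\<^sub>L A) + (adjoint_blinfun A o\<^sub>L adjoint_blinfun Q)
           \<preceq> - \<alpha> *\<^sub>R (adjoint_blinfun T o\<^sub>L T)"
  have "\<exists>C>0. \<forall>x. PIE_solution T A x \<longrightarrow>
      energy_bound (\<lambda>t. T (x t)) (C * norm (id_blinfun (x 0)))"
  proof (rule Lyapunov_energy_estimate)
    show "u \<bullet> Q (T v) = Q (T u) \<bullet> v" for u v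
      using self_adjoint_blinfun_sym[OF QT(1), of u v] by simp
    show "0 \<le> u \<bullet> Q (T u)" for u
      using QT(2) by (simp add: op_le_def)
    show "u \<bullet> Q (T u) \<le> (norm (Q o\<^sub>L T) + 1) * (norm (id_blinfun u))\<^sup>2" for u
      using inner_blinfun_self_le[of u "Q o\<^sub>L T"] by simp
    show "2 * (u \<bullet> Q (A u)) \<le> - \<alpha> * (norm (T u))\<^sup>2" for u
      using dis unfolding op_le_def inner_self_add_adjoint
      by (simp add: blinfun.scaleR_left blinfun.minus_left inner_adjoint_self)
  qed (use \<open>\<alpha> > 0\<close> in \<open>auto simp: add_nonneg_pos\<close>)
  then show "FE_PIE_to_PDE_stable T A"
    by (simp add: FE_PIE_to_PDE_stable_def)
next
  fix Q :: "'m L2 \<Rightarrow>\<^sub>L 'm L2" and \<alpha> :: real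
  assume QT: "(Q o\<^sub>L T) = adjoint_blinfun (Q o\<^sub>L T)" "0 \<preceq> (Q o\<^sub>L T)" and "\<alpha> > 0"
    and dis: "(Q o\<^sub>L A) + (adjoint_blinfun A o\<^sub>L adjoint_blinfun Q) \<preceq> - \<alpha> *\<^sub>R id_blinfun"
  have "\<exists>C>0. \<forall>x. PIE_solution T A x \<longrightarrow>
      energy_bound (\<lambda>t. id_blinfun (x t)) (C * norm (id_blinfun (x 0)))"
  proof (rule Lyapunov_energy_estimate)
    show "u \<bullet> Q (T v) = Q (T u) \<bullet> v" for u v
      using self_adjoint_blinfun_sym[OF QT(1), of u v] by simp
    show "0 \<le> u \<bullet> Q (T u)" for u
      using QT(2) by (simp add: op_le_def)
    show "u \<bullet> Q (T u) \<le> (norm (Q o\<^sub>L T) + 1) * (norm (id_blinfun u))\<^sup>2" for u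
      using inner_blinfun_self_le[of u "Q o\<^sub>L T"] by simp
    show "2 * (u \<bullet> Q (A u)) \<le> - \<alpha> * (norm (id_blinfun u))\<^sup>2" for u
      using dis unfolding op_le_def inner_self_add_adjoint
      by (simp add: blinfun.scaleR_left blinfun.minus_left power2_norm_eq_inner)
  qed (use \<open>\<alpha> > 0\<close> in \<open>auto simp: add_nonneg_pos\<close>)
  then show "FE_PIE_stable T A"
    by (simp add: FE_PIE_stable_def)
next
  fix P :: "'m L2 \<Rightarrow>\<^sub>L 'm L2" and \<alpha> :: real
  assume P: "P = adjoint_blinfun P" "0 \<preceq> P" and "\<alpha> > 0"
    and dis: "(adjoint_blinfun T o\<^sub>L P o\<^sub>L A) + (adjoint_blinfun A o\<^sub>L P o\<^sub>L T)
           \<preceq> - \<alpha> *\<^sub>R (adjoint_blinfun T o\<^sub>L T)"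
  note P_sym = self_adjoint_blinfun_sym[OF P(1)]
  \<comment> \<open>Here \<open>Q = T\<^sup>* P\<close>, so every form in \<open>u\<close> becomes a form in \<open>T u\<close>.\<close>
  have "\<exists>C>0. \<forall>x. PIE_solution T A x \<longrightarrow> energy_bound (\<lambda>t. T (x t)) (C * norm (T (x 0)))"
  proof (rule Lyapunov_energy_estimate[where Q = "adjoint_blinfun T o\<^sub>L P"])
    show "u \<bullet> (adjoint_blinfun T o\<^sub>L P) (T v) = (adjoint_blinfun T o\<^sub>L P) (T u) \<bullet> v" for u v
      using P_sym[of "T u" "T v"] by (simp add: inner_adjoint_blinfun_left flip: inner_adjoint_blinfun)
    show "0 \<le> u \<bullet> (adjoint_blinfun T o\<^sub>L P) (T u)" for u
      using P(2) by (simp add: op_le_def flip: inner_adjoint_blinfun)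
    show "u \<bullet> (adjoint_blinfun T o\<^sub>L P) (T u) \<le> (norm P + 1) * (norm (T u))\<^sup>2" for u
      using inner_blinfun_self_le[of "T u" P] by (simp flip: inner_adjoint_blinfun)
    show "2 * (u \<bullet> (adjoint_blinfun T o\<^sub>L P) (A u)) \<le> - \<alpha> * (norm (T u))\<^sup>2" for u
    proof -
      have "u \<bullet> adjoint_blinfun A (P (T u)) = u \<bullet> adjoint_blinfun T (P (A u))"
        using P_sym[of "T u" "A u"] inner_commute[of "A u" "P (T u)"]
        by (simp flip: inner_adjoint_blinfun)
      then show ?thesis
        using dis[unfolded op_le_def, rule_format, of u]
        by (simp add: blinfun.scaleR_left blinfun.minus_left blinfun.add_left inner_add_right
            inner_adjoint_self)
    qed
  qed (use \<open>\<alpha> > 0\<close> in \<open>auto simp: add_nonneg_pos\<close>)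
  then show "FE_PDE_stable T A"
    by (simp add: FE_PDE_stable_def)
next
  fix Q :: "'m L2 \<Rightarrow>\<^sub>L 'm L2" and C \<alpha> :: real
  assume QT: "(Q o\<^sub>L T) = adjoint_blinfun (Q o\<^sub>L T)" "0 \<preceq> (Q o\<^sub>L T)"
    and upper: "(Q o\<^sub>L T) \<preceq> C *\<^sub>R (adjoint_blinfun T o\<^sub>L T)" and "C > 0" "\<alpha> > 0"
    and dis: "(Q o\<^sub>L A) + (adjoint_blinfun A o\<^sub>L adjoint_blinfun Q) \<preceq> - \<alpha> *\<^sub>R id_blinfun"
  have "\<exists>C>0. \<forall>x. PIE_solution T A x \<longrightarrow>
      energy_bound (\<lambda>t. id_blinfun (x t)) (C * norm (T (x 0)))"
  proof (rule Lyapunov_energy_estimate)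
    show "u \<bullet> Q (T v) = Q (T u) \<bullet> v" for u v
      using self_adjoint_blinfun_sym[OF QT(1), of u v] by simp
    show "0 \<le> u \<bullet> Q (T u)" for u
      using QT(2) by (simp add: op_le_def)
    show "u \<bullet> Q (T u) \<le> C * (norm (T u))\<^sup>2" for u
      using upper[unfolded op_le_def, rule_format, of u]
      by (simp add: blinfun.scaleR_left inner_adjoint_self)
    show "2 * (u \<bullet> Q (A u)) \<le> - \<alpha> * (norm (id_blinfun u))\<^sup>2" for u
      using dis unfolding op_le_def inner_self_add_adjoint
      by (simp add: blinfun.scaleR_left blinfun.minus_left power2_norm_eq_inner)
  qed (use \<open>C > 0\<close> \<open>\<alpha> > 0\<close> in auto)
  then show "FE_PDE_to_PIE_stable T A"
    by (simp add: FE_PDE_to_PIE_stable_def)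
qed

end
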